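(* Let $(\mathscr{G},\{\cdot_\lambda\}_{\lambda\in\Lambda},\{\vartriangleright_\lambda\}_{\lambda\in\Lambda})$ be a dynamical post-group, $\mathscr{G}=(G,\Lambda,\phi_G)$. Then the identity map $\mathrm{Id}:G\to G$ is a relative Rota-Baxter operator on the sub-adjacent dynamical group $(\mathscr{G},\{\circ_\lambda\}_{\lambda\in\Lambda})$, $a\circ_\lambda b=a\cdot_\lambda(a\vartriangleright_\lambda b)$, with respect to the action $L^{\rhd_\lambda}:G\to\mathrm{Bij}(G)$, $L^{\rhd_\lambda}(a)(b)=a\vartriangleright_\lambda b$, of $(\mathscr{G},\{\circ_\lambda\})$ on the constant dynamical group $(G,\Lambda,\{\cdot_\lambda\})$.
   Context: Fix a set $\Lambda$. A dynamical set is a triple $(X,\Lambda,\phi_X)$ with $X$ a set and $\phi_X:\Lambda\times X\to\Lambda$ a map. Dynamical group: a dynamical set $\mathscr{G}=(G,\Lambda,\phi_G)$ with maps $\circ_\lambda:G\times G\to G$ ($\lambda\in\Lambda$) such that $\phi_G(\lambda,a\circ_\lambda b)=\phi_G(\phi_G(\lambda,a),b)$ and $a\circ_\lambda(b\circ_{\phi_G(\lambda,a)}c)=(a\circ_\lambda b)\circ_\lambda c$; an element $e_G$ with $a\circ_\lambda e_G=e_G\circ_\lambda a=a$ and $\phi_G(\lambda,e_G)=\lambda$; and for all $\lambda,a$ an element $\bar a^\lambda$ with $a\circ_\lambda\bar a^\lambda=\bar a^\lambda\circ_{\phi_G(\lambda,a)}a=e_G$. A constant dynamical group is a dynamical group whose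 structure map is $(\lambda,x)\mapsto\lambda$, i.e. a family of group structures $\cdot_\lambda$ ($\lambda\in\Lambda$) on one set with a common unit; $a^\lambda$ denotes the inverse of $a$ for $\cdot_\lambda$. Dynamical post-group: a dynamical set $\mathscr{G}=(G,\Lambda,\phi_G)$ with maps $\cdot_\lambda,\vartriangleright_\lambda:G\times G\to G$ ($\lambda\in\Lambda$) such that $(G,\Lambda,\{\cdot_\lambda\})$ is a constant dynamical group, with unit $e_G$; and for all $\lambda\in\Lambda$, $a,b,c\in G$: $a\vartriangleright_\lambda(b\cdot_{\phi_G(\lambda,a)}c)=(a\vartriangleright_\lambda b)\cdot_\lambda(a\vartriangleright_\lambda c)$; $(a\cdot_\lambda(a\vartriangleright_\lambda b))\vartriangleright_\lambda c=a\vartriangleright_\lambda(b\vartriangleright_{\phi_G(\lambda,a)}c)$; and the map $L^{\rhd_\lambda}_a:G\to G$, $b\mapsto a\vartriangleright_\lambda b$, is invertible. Its sub-adjacent dynamical group is $(\mathscr{G},\{\circ_\lambda\})$ with $a\circ_\lambda b=a\cdot_\lambda(a\vartriangleright_\lambda b)$, unit $e_G$ and inverses $\bar a^\lambda=(L^{\rhd_\lambda}_a)^{-1}(a^\lambda)$. Action of a dynamical group $\mathscr{G}$ on a constant dynamical group $(H,\Lambda,\{\cdot_\lambda\})$: maps $\Phi_\lambda:G\to\mathrm{Bij}(H)$ (bijections of the set $H$) with $\Phi_\lambda(a)(x\cdot_{\phi_G(\lambda,a)}y)=(\Phi_\lambda(a)x)\cdot_\lambda(\Phi_\lambda(a)y)$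 and $\Phi_\lambda(a\circ_\lambda b)=\Phi_\lambda(a)\Phi_{\phi_G(\lambda,a)}(b)$. A relative Rota-Baxter operator on $\mathscr{G}$ with respect to $\Phi$ is a map $\mathcal{B}:H\to G$ with $\mathcal{B}(x)\circ_\lambda\mathcal{B}(y)=\mathcal{B}(x\cdot_\lambda\Phi_\lambda(\mathcal{B}(x))(y))$ for all $\lambda\in\Lambda$, $x,y\in H$.
   Formalization: The action laws and Rota-Baxter identity hold as stated; that the sub-adjacent structure is a dynamical group, and so the full claim, is proved assuming φ_G(λ,e_G)=λ and φ_G(λ,a∘_λ b)=φ_G(φ_G(λ,a),b), which the post-group axioms do not imply. *)

theory Defs
  imports "HOL-Library.FuncSet"
begin

text \<open>
  All structures live on carrier sets \<open>G\<close>, \<open>H\<close> and on a parameter set \<open>\<Lambda>\<close>; families indexed by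
  \<open>\<lambda> \<in> \<Lambda>\<close> are curried, with the parameter (written \<open>l\<close>) as first argument.
  Nothing is required outside the carriers.
\<close>

locale dynamical_set =
  fixes G :: "'a set" and \<Lambda> :: "'l set" and \<phi> :: "'l \<Rightarrow> 'a \<Rightarrow> 'l"
  assumes structure_map: "\<lbrakk>l \<in> \<Lambda>; a \<in> G\<rbrakk> \<Longrightarrow> \<phi> l a \<in> \<Lambda>"

locale dynamical_group = dynamical_set G \<Lambda> \<phi>
  for G :: "'a set" and \<Lambda> :: "'l set" and \<phi> :: "'l \<Rightarrow> 'a \<Rightarrow> 'l" +
  fixes mult :: "'l \<Rightarrow> 'a \<Rightarrow> 'a \<Rightarrow> 'a" and e :: 'a
  assumes mult_closed: "\<lbrakk>l \<in> \<Lambda>; a \<in> G; b \<in> G\<rbrakk> \<Longrightarrow> mult l a b \<in> G"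
    and structure_map_mult:
      "\<lbrakk>l \<in> \<Lambda>; a \<in> G; b \<in> G\<rbrakk> \<Longrightarrow> \<phi> l (mult l a b) = \<phi> (\<phi> l a) b"
    and mult_assoc:
      "\<lbrakk>l \<in> \<Lambda>; a \<in> G; b \<in> G; c \<in> G\<rbrakk>
        \<Longrightarrow> mult l a (mult (\<phi> l a) b c) = mult l (mult l a b) c"
    and unit_closed: "e \<in> G"
    and mult_unit: "\<lbrakk>l \<in> \<Lambda>; a \<in> G\<rbrakk> \<Longrightarrow> mult l a e = a"
    and unit_mult: "\<lbrakk>l \<in> \<Lambda>; a \<in> G\<rbrakk> \<Longrightarrow> mult l e a = a"
    and structure_map_unit: "l \<in> \<Lambda> \<Longrightarrow> \<phi> l e = l"
    and inverse_exists:
      "\<lbrakk>l \<in> \<Lambda>; a \<in> G\<rbrakk> \<Longrightarrow> \<exists>a'\<in>G. mult l a a' = e \<and> mult (\<phi> l a) a' a = e"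

locale constant_dynamical_group = dynamical_group G \<Lambda> "\<lambda>l a. l" mult e
  for G :: "'a set" and \<Lambda> :: "'l set"
    and mult :: "'l \<Rightarrow> 'a \<Rightarrow> 'a \<Rightarrow> 'a" and e :: 'a

locale dynamical_post_group =
  dynamical_set G \<Lambda> \<phi> + constant_dynamical_group G \<Lambda> dot e
  for G :: "'a set" and \<Lambda> :: "'l set" and \<phi> :: "'l \<Rightarrow> 'a \<Rightarrow> 'l"
    and dot :: "'l \<Rightarrow> 'a \<Rightarrow> 'a \<Rightarrow> 'a" and e :: 'a +
  fixes rhd :: "'l \<Rightarrow> 'a \<Rightarrow> 'a \<Rightarrow> 'a"
  assumes rhd_closed: "\<lbrakk>l \<in> \<Lambda>; a \<in> G; b \<in> G\<rbrakk> \<Longrightarrow> rhd l a b \<in> G"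
    and rhd_dot:
      "\<lbrakk>l \<in> \<Lambda>; a \<in> G; b \<in> G; c \<in> G\<rbrakk>
        \<Longrightarrow> rhd l a (dot (\<phi> l a) b c) = dot l (rhd l a b) (rhd l a c)"
    and dot_rhd:
      "\<lbrakk>l \<in> \<Lambda>; a \<in> G; b \<in> G; c \<in> G\<rbrakk>
        \<Longrightarrow> rhd l (dot l a (rhd l a b)) c = rhd l a (rhd (\<phi> l a) b c)"
    and rhd_bij: "\<lbrakk>l \<in> \<Lambda>; a \<in> G\<rbrakk> \<Longrightarrow> bij_betw (rhd l a) G G"

definition sub_adjacent ::
  "('l \<Rightarrow> 'a \<Rightarrow> 'a \<Rightarrow> 'a) \<Rightarrow> ('l \<Rightarrow> 'a \<Rightarrow> 'a \<Rightarrow> 'a) \<Rightarrow> 'l \<Rightarrow> 'a \<Rightarrow> 'a \<Rightarrow> 'a"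
  where "sub_adjacent dot rhd l a b = dot l a (rhd l a b)"

text \<open>
  The axioms of a dynamical post-group do not link \<open>\<phi>\<close> to the products: if every \<open>rhd l a\<close> is the
  identity and \<open>dot l\<close> is one fixed group law, all axioms hold for an arbitrary \<open>\<phi>\<close>. The
  sub-adjacent operations form a dynamical group for \<open>\<phi>\<close> exactly when \<open>\<phi>\<close> satisfies the two
  conditions that the definition of a dynamical group imposes on it. For this reason the equations
  defining an action and a relative Rota-Baxter operator are kept separate from the
  structures they are stated for.
\<close>

locale action_laws =
  fixes G :: "'a set" and \<Lambda> :: "'l set" and \<phi> :: "'l \<Rightarrow> 'a \<Rightarrow> 'l"
    and mult :: "'l \<Rightarrow> 'a \<Rightarrow> 'a \<Rightarrow> 'a"
    and H :: "'b set" and multH :: "'l \<Rightarrow> 'b \<Rightarrow> 'b \<Rightarrow> 'b"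
    and \<Phi> :: "'l \<Rightarrow> 'a \<Rightarrow> 'b \<Rightarrow> 'b"
  assumes action_bij: "\<lbrakk>l \<in> \<Lambda>; a \<in> G\<rbrakk> \<Longrightarrow> bij_betw (\<Phi> l a) H H"
    and action_multH:
      "\<lbrakk>l \<in> \<Lambda>; a \<in> G; x \<in> H; y \<in> H\<rbrakk>
        \<Longrightarrow> \<Phi> l a (multH (\<phi> l a) x y) = multH l (\<Phi> l a x) (\<Phi> l a y)"
    and action_mult:
      "\<lbrakk>l \<in> \<Lambda>; a \<in> G; b \<in> G; x \<in> H\<rbrakk>
        \<Longrightarrow> \<Phi> l (mult l a b) x = \<Phi> l a (\<Phi> (\<phi> l a) b x)"

locale dynamical_group_action =
  dynamical_group G \<Lambda> \<phi> mult e + H: constant_dynamical_group H \<Lambda> multH eH +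
  action_laws G \<Lambda> \<phi> mult H multH \<Phi>
  for G :: "'a set" and \<Lambda> :: "'l set" and \<phi> :: "'l \<Rightarrow> 'a \<Rightarrow> 'l"
    and mult :: "'l \<Rightarrow> 'a \<Rightarrow> 'a \<Rightarrow> 'a" and e :: 'a
    and H :: "'b set" and multH :: "'l \<Rightarrow> 'b \<Rightarrow> 'b \<Rightarrow> 'b" and eH :: 'b
    and \<Phi> :: "'l \<Rightarrow> 'a \<Rightarrow> 'b \<Rightarrow> 'b"

locale rota_baxter_law =
  fixes G :: "'a set" and \<Lambda> :: "'l set"
    and mult :: "'l \<Rightarrow> 'a \<Rightarrow> 'a \<Rightarrow> 'a"
    and H :: "'b set" and multH :: "'l \<Rightarrow> 'b \<Rightarrow> 'b \<Rightarrow> 'b"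
    and \<Phi> :: "'l \<Rightarrow> 'a \<Rightarrow> 'b \<Rightarrow> 'b"
    and B :: "'b \<Rightarrow> 'a"
  assumes operator_maps: "B \<in> H \<rightarrow> G"
    and rota_baxter:
      "\<lbrakk>l \<in> \<Lambda>; x \<in> H; y \<in> H\<rbrakk>
        \<Longrightarrow> mult l (B x) (B y) = B (multH l x (\<Phi> l (B x) y))"

locale relative_rota_baxter_operator =
  dynamical_group_action G \<Lambda> \<phi> mult e H multH eH \<Phi> +
  rota_baxter_law G \<Lambda> mult H multH \<Phi> B
  for G :: "'a set" and \<Lambda> :: "'l set" and \<phi> :: "'l \<Rightarrow> 'a \<Rightarrow> 'l"
    and mult :: "'l \<Rightarrow> 'a \<Rightarrow> 'a \<Rightarrow> 'a" and e :: 'a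
    and H :: "'b set" and multH :: "'l \<Rightarrow> 'b \<Rightarrow> 'b \<Rightarrow> 'b" and eH :: 'b
    and \<Phi> :: "'l \<Rightarrow> 'a \<Rightarrow> 'b \<Rightarrow> 'b" and B :: "'b \<Rightarrow> 'a"

end

theory Submission
  imports Defs
begin

text \<open>
  With \<open>a \<circ>\<^sub>l b = a \<cdot>\<^sub>l (a \<rhd>\<^sub>l b)\<close>, the action laws are post-group axioms and the Rota-Baxter
  identity for \<open>id\<close> is the definition of \<open>\<circ>\<^sub>l\<close>. It remains to see that \<open>\<circ>\<close> is a dynamical
  group once \<open>\<phi>\<close> is compatible with it: associativity unfolds to the two post-group laws, \<open>a \<rhd>\<^sub>l e\<close>
  is idempotent for \<open>\<cdot>\<^sub>l\<close>, \<open>e \<rhd>\<^sub>l _\<close> is an injective idempotent map, and right inverses exist because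
  \<open>a \<rhd>\<^sub>l _\<close> is surjective. As in a group, right inverses are then two-sided.
\<close>

context dynamical_post_group
begin

text \<open>Both parent structures supply a fact \<open>structure_map\<close>, one for
  \<open>\<phi>\<close> and one for the constant map; this keeps the former under its own
  name.\<close>

lemma phi_closed: "\<lbrakk>l \<in> \<Lambda>; a \<in> G\<rbrakk> \<Longrightarrow> \<phi> l a \<in> \<Lambda>"
  using dynamical_post_group_axioms
  by (auto simp: dynamical_post_group_def dynamical_set_def)

lemma sub_adjacent_closed:
  "\<lbrakk>l \<in> \<Lambda>; a \<in> G; b \<in> G\<rbrakk> \<Longrightarrow> sub_adjacent dot rhd l a b \<in> G"
  by (simp add: sub_adjacent_def mult_closed rhd_closed)

lemma dot_idempotent_eq_unit:
  assumes "l \<in> \<Lambda>" "x \<in> G" "dot l x x = x"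
  shows "x = e"
proof -
  obtain x' where x': "x' \<in> G" "dot l x x' = e"
    using inverse_exists assms(1,2) by blast
  have "x = dot l x (dot l x x')"
    using assms x' by (simp add: mult_unit)
  also have "\<dots> = dot l (dot l x x) x'"
    using assms(1,2) x'(1) by (intro mult_assoc)
  finally show ?thesis
    using assms x' by simp
qed

lemma rhd_unit:
  assumes "l \<in> \<Lambda>" "a \<in> G"
  shows "rhd l a e = e"
proof (rule dot_idempotent_eq_unit)
  \<comment> \<open>\<open>rhd_dot\<close> multiplies the arguments at \<open>\<phi> l a\<close>;
    the unit is common to all parameters, so \<open>e\<close> serves there too.\<close>
  have "dot (\<phi> l a) e e = e"
    using assms by (simp add: mult_unit unit_closed phi_closed)
  then show "dot l (rhd l a e) (rhd l a e) = rhd l a e"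
    using rhd_dot[OF assms unit_closed unit_closed] by simp
qed (use assms in \<open>auto intro: rhd_closed unit_closed\<close>)

lemma unit_rhd:
  assumes "l \<in> \<Lambda>" "b \<in> G" "\<phi> l e = l"
  shows "rhd l e b = b"
proof -
  \<comment> \<open>Since \<open>\<phi> l e = l\<close>, both factors in \<open>dot_rhd\<close> act
    at the same parameter, and injectivity can later cancel the outer one.\<close>
  have "rhd l e (rhd l e b) = rhd l (dot l e (rhd l e e)) b"
    using assms by (simp add: dot_rhd unit_closed)
  also have "\<dots> = rhd l e b"
    using assms by (simp add: rhd_unit unit_closed mult_unit)
  finally show ?thesis
    using rhd_bij[of l e] assms unit_closed rhd_closed
    by (auto simp: bij_betw_def dest: inj_onD)
qed

lemma sub_adjacent_unit:
  "\<lbrakk>l \<in> \<Lambda>; a \<in> G\<rbrakk> \<Longrightarrow> sub_adjacent dot rhd l a e = a"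
  by (simp add: sub_adjacent_def rhd_unit mult_unit)

lemma unit_sub_adjacent:
  "\<lbrakk>l \<in> \<Lambda>; a \<in> G; \<phi> l e = l\<rbrakk> \<Longrightarrow> sub_adjacent dot rhd l e a = a"
  by (simp add: sub_adjacent_def unit_rhd unit_mult)

text \<open>\<open>rhd_dot\<close> distributes the outer action of \<open>a\<close>,
  \<open>dot_rhd\<close> folds the nested actions into one, and associativity of
  \<open>dot l\<close> regroups.\<close>

lemma sub_adjacent_assoc:
  "\<lbrakk>l \<in> \<Lambda>; a \<in> G; b \<in> G; c \<in> G\<rbrakk> \<Longrightarrow>
    sub_adjacent dot rhd l a (sub_adjacent dot rhd (\<phi> l a) b c) =
    sub_adjacent dot rhd l (sub_adjacent dot rhd l a b) c"
  by (simp add: sub_adjacent_def rhd_dot dot_rhd mult_assoc rhd_closed phi_closed)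

lemma sub_adjacent_right_inverse:
  assumes "l \<in> \<Lambda>" "a \<in> G"
  obtains a' where "a' \<in> G" "sub_adjacent dot rhd l a a' = e"
proof -
  obtain b where b: "b \<in> G" "dot l a b = e"
    using inverse_exists assms by blast
  \<comment> \<open>The witness is the preimage under \<open>rhd l a\<close> of the
    \<open>dot l\<close>-inverse \<open>b\<close> of \<open>a\<close>.\<close>
  have "b \<in> rhd l a ` G"
    using b(1) bij_betw_imp_surj_on[OF rhd_bij[OF assms]] by simp
  then obtain a' where "a' \<in> G" "rhd l a a' = b"
    by (elim imageE) simp
  with b show thesis
    using that by (auto simp: sub_adjacent_def)
qed

lemma dynamical_group_sub_adjacent:
  assumes phi_unit: "\<And>l. l \<in> \<Lambda> \<Longrightarrow> \<phi> l e = l"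
    and phi_mult: "\<And>l a b. \<lbrakk>l \<in> \<Lambda>; a \<in> G; b \<in> G\<rbrakk>
      \<Longrightarrow> \<phi> l (sub_adjacent dot rhd l a b) = \<phi> (\<phi> l a) b"
  shows "dynamical_group G \<Lambda> \<phi> (sub_adjacent dot rhd) e"
proof
  fix l a assume la: "l \<in> \<Lambda>" "a \<in> G"
  let ?m = "\<phi> l a"
  have m: "?m \<in> \<Lambda>"
    using la by (rule phi_closed)
  obtain a' where a': "a' \<in> G" "sub_adjacent dot rhd l a a' = e"
    using la by (rule sub_adjacent_right_inverse)
  \<comment> \<open>This right inverse is taken at \<open>\<phi> l a\<close>, the parameter of the
    inner product in associativity; evaluating both bracketings of \<open>a\<close>,
    \<open>a'\<close>, \<open>a''\<close> gives \<open>a = a''\<close>.\<close>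
  obtain a'' where a'': "a'' \<in> G" "sub_adjacent dot rhd ?m a' a'' = e"
    using m a'(1) by (rule sub_adjacent_right_inverse)
  have "a = sub_adjacent dot rhd l a (sub_adjacent dot rhd ?m a' a'')"
    using la a'' by (simp add: sub_adjacent_unit)
  also have "\<dots> = sub_adjacent dot rhd l (sub_adjacent dot rhd l a a') a''"
    using la a'(1) a''(1) by (rule sub_adjacent_assoc)
  also have "\<dots> = a''"
    using la a' a'' by (simp add: unit_sub_adjacent phi_unit)
  finally show "\<exists>a'\<in>G. sub_adjacent dot rhd l a a' = e \<and> sub_adjacent dot rhd ?m a' a = e"
    using a' a'' by blast
qed (simp_all add: phi_closed sub_adjacent_closed phi_mult sub_adjacent_assoc unit_closed
    sub_adjacent_unit unit_sub_adjacent phi_unit)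

lemma action_laws_sub_adjacent: "action_laws G \<Lambda> \<phi> (sub_adjacent dot rhd) G dot rhd"
  by unfold_locales (simp_all add: rhd_bij rhd_dot dot_rhd sub_adjacent_def)

lemma rota_baxter_law_sub_adjacent: "rota_baxter_law G \<Lambda> (sub_adjacent dot rhd) G dot rhd id"
  by unfold_locales (simp_all add: sub_adjacent_def)

end

theorem proposition4p10:
  fixes G :: "'a set" and \<Lambda> :: "'l set" and \<phi> :: "'l \<Rightarrow> 'a \<Rightarrow> 'l"
    and dot rhd :: "'l \<Rightarrow> 'a \<Rightarrow> 'a \<Rightarrow> 'a" and e :: 'a
  assumes "dynamical_post_group G \<Lambda> \<phi> dot e rhd"
  shows "action_laws G \<Lambda> \<phi> (sub_adjacent dot rhd) G dot rhd
       \<and> rota_baxter_law G \<Lambda> (sub_adjacent dot rhd) G dot rhd id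
       \<and> ((\<forall>l\<in>\<Lambda>. \<phi> l e = l \<and>
             (\<forall>a\<in>G. \<forall>b\<in>G. \<phi> l (sub_adjacent dot rhd l a b) = \<phi> (\<phi> l a) b))
          \<longrightarrow> relative_rota_baxter_operator
                G \<Lambda> \<phi> (sub_adjacent dot rhd) e G dot e rhd id)"
proof -
  interpret dynamical_post_group G \<Lambda> \<phi> dot e rhd
    by (fact assms)
  show ?thesis
    \<comment> \<open>The compatibility conditions on \<open>\<phi>\<close> enter only through
      \<open>dynamical_group_sub_adjacent\<close>.\<close>
    using dynamical_group_sub_adjacent constant_dynamical_group_axioms
      action_laws_sub_adjacent rota_baxter_law_sub_adjacent
    by (simp add: relative_rota_baxter_operator_def dynamical_group_action_def)
qed

end
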